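(* Let $n=d=3$ and let $f=\sum_{\alpha\in\mathscr W_3}c_\alpha m^\alpha$ be a nonzero homogeneous cubic polynomial in $x_1,x_2,x_3$ with complex coefficients $c_\alpha$. Put $L=\overline{w(f)}\cdot w(f)$, let $P$ be the $3\times 3$ matrix with entries $P_{ij}=\overline{w(\partial f/\partial x_i)}\cdot w(\partial f/\partial x_j)$, and set $$m=2\left(\frac{1}{3L}\,P-I\right),\qquad \ell=\mathrm{Re}\,(\mathrm{Tr}(m\,m)),$$ where $I$ is the $3\times3$ identity matrix. Then $m$ is the moment matrix $\mathfrak m(f)$ of $f$, and $\ell$ is the square length $\|\mathfrak m(f)\|^2$. In particular, if $f$ is a nonzero homogeneous cubic polynomial with real coefficients, the same construction gives the moment matrix of $f$ and its square length.
   Context: For an integer $e\ge 0$ let $\mathscr W_e=\{\alpha=(\alpha_1,\alpha_2,\alpha_3)\in\mathbb Z_{\ge0}^3 : \alpha_1+\alpha_2+\alpha_3=e\}$ and $m^\alpha=x_1^{\alpha_1}x_2^{\alpha_2}x_3^{\alpha_3}$. On the complex vector space of homogeneous polynomials of degree $e$ in $x_1,x_2,x_3$, let $\langle\,,\,\rangle$ be the hermitian product (linear in the first argument, conjugate-linear in the second) for which the monomials $m^\alpha$, $\alpha\in\mathscr W_e$, are orthogonal and $\|m^\alpha\|^2=\langle m^\alpha,m^\alpha\rangle=\frac{\alpha_1!\alpha_2!\alpha_3!}{e!}$; write $\|f\|^2=\langle f,f\rangle$. Weighted coefficient vector: for a homogeneous polynomial $g=\sum_{\alpha\in\mathscr W_e}g_\alpha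 m^\alpha$ of degree $e$, $w(g)=\left(\sqrt{\tfrac{\alpha_1!\alpha_2!\alpha_3!}{e!}}\;g_\alpha\right)_{\alpha\in\mathscr W_e}$, where the monomials are listed in a fixed order. The bar denotes entrywise complex conjugation and $u\cdot v=\sum_\alpha u_\alpha v_\alpha$. Moment matrix: for a nonzero homogeneous polynomial $f$ of degree $d$ in $n$ variables, $\mathfrak m(f)=2\left(H(f)-\frac dn I\right)$, where $H(f)$ is the $n\times n$ hermitian matrix whose $(i,j)$-th entry is $\frac{1}{\|f\|^2}\cdot\frac1d\left\langle\frac{\partial f}{\partial x_j},\frac{\partial f}{\partial x_i}\right\rangle$. The square length of the moment matrix is $\|\mathfrak m(f)\|^2=\mathrm{Re}\,(\mathrm{Tr}(\mathfrak m(f)\,\mathfrak m(f)))$. Here $n=d=3$. *)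

theory Defs
  imports "HOL-Analysis.Analysis" "HOL-Library.Poly_Mapping"
begin

text \<open>
  Complex polynomials in finitely many variables, indexed by a finite type, as finitely supported
  functions from exponents to coefficients.  The index type \<open>3\<close> has exactly the
  elements \<open>1, 2, 3\<close> (with \<open>3 = 0\<close>).
\<close>

type_synonym 'n expo = "'n \<Rightarrow>\<^sub>0 nat"
type_synonym 'n cpoly = "'n expo \<Rightarrow>\<^sub>0 complex"

abbreviation coeff_at :: "'n cpoly \<Rightarrow> 'n expo \<Rightarrow> complex"
  where "coeff_at f \<alpha> \<equiv> Poly_Mapping.lookup f \<alpha>"

abbreviation monomial :: "'n expo \<Rightarrow> 'n cpoly"
  where "monomial \<alpha> \<equiv> Poly_Mapping.single \<alpha> 1"

definition cmul :: "complex \<Rightarrow> 'n cpoly \<Rightarrow> 'n cpoly"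
  where "cmul a f = Poly_Mapping.map ((*) a) f"

definition exponents :: "nat \<Rightarrow> ('n::finite) expo set"
  where "exponents e = {\<alpha>. (\<Sum>i\<in>UNIV. Poly_Mapping.lookup \<alpha> i) = e}"

text \<open>As usual, \<open>0\<close> counts as homogeneous of every degree.\<close>

definition homogeneous :: "nat \<Rightarrow> ('n::finite) cpoly \<Rightarrow> bool"
  where "homogeneous e f \<longleftrightarrow> Poly_Mapping.keys f \<subseteq> exponents e"

text \<open>
  If \<open>i\<close> does not occur in \<open>\<alpha>\<close>, the truncated subtraction is harmless: the coefficient is \<open>0\<close>.
\<close>

definition partial :: "'n \<Rightarrow> 'n cpoly \<Rightarrow> 'n cpoly"
  where "partial i f = (\<Sum>\<alpha>\<in>Poly_Mapping.keys f.
    Poly_Mapping.single (\<alpha> - Poly_Mapping.single i 1)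
      (of_nat (Poly_Mapping.lookup \<alpha> i) * coeff_at f \<alpha>))"

definition expo_weight :: "nat \<Rightarrow> ('n::finite) expo \<Rightarrow> real"
  where "expo_weight e \<alpha> = (\<Prod>i\<in>UNIV. fact (Poly_Mapping.lookup \<alpha> i)) / fact e"

text \<open>
  The hermitian products on the space of homogeneous polynomials of degree \<open>e\<close> prescribed on
  monomials.  Conjugate-linearity in the second argument follows from the first three clauses.
\<close>

definition is_monomial_hermitian :: "nat \<Rightarrow> (('n::finite) cpoly \<Rightarrow> 'n cpoly \<Rightarrow> complex) \<Rightarrow> bool"
  where "is_monomial_hermitian e B \<longleftrightarrow>
    (\<forall>f g h. homogeneous e f \<longrightarrow> homogeneous e g \<longrightarrow> homogeneous e h \<longrightarrow>
       B (f + g) h = B f h + B g h) \<and>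
    (\<forall>a f h. homogeneous e f \<longrightarrow> homogeneous e h \<longrightarrow> B (cmul a f) h = a * B f h) \<and>
    (\<forall>f g. homogeneous e f \<longrightarrow> homogeneous e g \<longrightarrow> B g f = cnj (B f g)) \<and>
    (\<forall>\<alpha>\<in>exponents e. \<forall>\<beta>\<in>exponents e. \<alpha> \<noteq> \<beta> \<longrightarrow> B (monomial \<alpha>) (monomial \<beta>) = 0) \<and>
    (\<forall>\<alpha>\<in>exponents e. B (monomial \<alpha>) (monomial \<alpha>) = complex_of_real (expo_weight e \<alpha>))"

text \<open>
  The choice is unique on homogeneous polynomials of degree \<open>e\<close>; see \<open>herm_unique\<close> and
  \<open>herm_is_monomial_hermitian\<close> below.
\<close>

definition herm :: "nat \<Rightarrow> ('n::finite) cpoly \<Rightarrow> 'n cpoly \<Rightarrow> complex"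
  where "herm e = (SOME B. is_monomial_hermitian e B)"

definition gradient_gram :: "nat \<Rightarrow> ('n::finite) cpoly \<Rightarrow> complex^'n^'n"
  where "gradient_gram d f = (\<chi> i j.
    1 / herm d f f * (1 / of_nat d * herm (d - 1) (partial j f) (partial i f)))"

definition moment_matrix :: "nat \<Rightarrow> ('n::finite) cpoly \<Rightarrow> complex^'n^'n"
  where "moment_matrix d f =
    2 *\<^sub>R (gradient_gram d f - (real d / real CARD('n)) *\<^sub>R mat 1)"

definition square_length :: "complex^'n^'n \<Rightarrow> real"
  where "square_length M = Re (trace (M ** M))"

text \<open>
  Weighted coefficient vectors.  A vector indexed by the exponents of degree \<open>e\<close> is a function whose
  values on \<open>exponents e\<close> are its entries, so no listing of the monomials has to be fixed.
\<close>

definition wvec :: "nat \<Rightarrow> ('n::finite) cpoly \<Rightarrow> 'n expo \<Rightarrow> complex"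
  where "wvec e g \<alpha> = complex_of_real (sqrt (expo_weight e \<alpha>)) * coeff_at g \<alpha>"

definition conjvec :: "('n expo \<Rightarrow> complex) \<Rightarrow> 'n expo \<Rightarrow> complex"
  where "conjvec u \<alpha> = cnj (u \<alpha>)"

definition dotvec :: "nat \<Rightarrow> (('n::finite) expo \<Rightarrow> complex) \<Rightarrow> ('n expo \<Rightarrow> complex) \<Rightarrow> complex"
  where "dotvec e u v = (\<Sum>\<alpha>\<in>exponents e. u \<alpha> * v \<alpha>)"

definition cubic_L :: "3 cpoly \<Rightarrow> complex"
  where "cubic_L f = dotvec 3 (conjvec (wvec 3 f)) (wvec 3 f)"

definition cubic_P :: "3 cpoly \<Rightarrow> complex^3^3"
  where "cubic_P f =
    (\<chi> i j. dotvec 2 (conjvec (wvec 2 (partial i f))) (wvec 2 (partial j f)))"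

definition cubic_m :: "3 cpoly \<Rightarrow> complex^3^3"
  where "cubic_m f = 2 *\<^sub>R (map_matrix ((*) (1 / (3 * cubic_L f))) (cubic_P f) - mat 1)"

definition cubic_ell :: "3 cpoly \<Rightarrow> real"
  where "cubic_ell f = Re (trace (cubic_m f ** cubic_m f))"

lemma finite_exponents: "finite (exponents e :: ('n::finite) expo set)"
proof -
  have "Poly_Mapping.lookup ` (exponents e :: 'n expo set) \<subseteq> Pi\<^sub>E UNIV (\<lambda>_. {..e})"
    by (auto simp: exponents_def intro!: member_le_sum)
  then have "finite (Poly_Mapping.lookup ` (exponents e :: 'n expo set))"
    by (rule finite_subset) (simp add: finite_PiE)
  then show ?thesis
    by (rule finite_imageD) (simp add: inj_on_def)
qed

lemma coeff_at_cmul: "coeff_at (cmul a f) \<alpha> = a * coeff_at f \<alpha>"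
  by (simp add: cmul_def Poly_Mapping.map.rep_eq when_def)

lemma homogeneous_0: "homogeneous e 0"
  by (simp add: homogeneous_def)

lemma homogeneous_add: "homogeneous e f \<Longrightarrow> homogeneous e g \<Longrightarrow> homogeneous e (f + g)"
  unfolding homogeneous_def using Poly_Mapping.keys_add[of f g] by blast

lemma homogeneous_cmul: "homogeneous e f \<Longrightarrow> homogeneous e (cmul a f)"
  by (auto simp: homogeneous_def in_keys_iff coeff_at_cmul)

lemma homogeneous_monomial: "\<alpha> \<in> exponents e \<Longrightarrow> homogeneous e (monomial \<alpha>)"
  by (simp add: homogeneous_def)

lemma is_monomial_hermitian_exists:
  "is_monomial_hermitian e
     (\<lambda>f g. \<Sum>\<alpha>\<in>exponents e. complex_of_real (expo_weight e \<alpha>) * coeff_at f \<alpha> * cnj (coeff_at g \<alpha>))"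
  unfolding is_monomial_hermitian_def
proof (intro conjI allI impI ballI, goal_cases)
  case (1 f g h)
  show ?case by (simp add: lookup_add distrib_left distrib_right sum.distrib)
next
  case (2 a f h)
  show ?case by (simp add: coeff_at_cmul sum_distrib_left mult.left_commute mult.assoc)
next
  case (3 f g)
  show ?case by (simp add: mult.commute mult.left_commute)
next
  case (4 \<alpha> \<beta>)
  then show ?case by (intro sum.neutral) (auto simp: lookup_single when_def)
next
  case (5 \<alpha>)
  have "(\<Sum>\<beta>\<in>exponents e - {\<alpha>}. complex_of_real (expo_weight e \<beta>) *
      coeff_at (monomial \<alpha>) \<beta> * cnj (coeff_at (monomial \<alpha>) \<beta>)) = 0"
    by (intro sum.neutral) (auto simp: lookup_single when_def)
  with 5 show ?case
    by (simp add: sum.remove[OF finite_exponents])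
qed

lemma herm_is_monomial_hermitian: "is_monomial_hermitian e (herm e)"
  unfolding herm_def by (rule someI[of "is_monomial_hermitian e", OF is_monomial_hermitian_exists])

lemma homogeneous_induct [consumes 1, case_names zero step]:
  assumes "homogeneous e f" and "P 0"
    and "\<And>a \<alpha> g. \<alpha> \<in> exponents e \<Longrightarrow> homogeneous e g \<Longrightarrow> P g \<Longrightarrow> P (cmul a (monomial \<alpha>) + g)"
  shows "P f"
proof -
  have sum: "f = (\<Sum>\<alpha>\<in>Poly_Mapping.keys f. cmul (coeff_at f \<alpha>) (monomial \<alpha>))"
    by (rule poly_mapping_eqI)
      (simp add: lookup_sum coeff_at_cmul lookup_single when_def if_distrib[of "\<lambda>x. _ * x"]
        in_keys_iff cong: if_cong)
  have "A \<subseteq> exponents e \<Longrightarrow>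
      homogeneous e (\<Sum>\<alpha>\<in>A. cmul (coeff_at f \<alpha>) (monomial \<alpha>)) \<and>
      P (\<Sum>\<alpha>\<in>A. cmul (coeff_at f \<alpha>) (monomial \<alpha>))" if "finite A" for A
    using that
    by (induction A) (auto simp: assms homogeneous_0 homogeneous_add homogeneous_cmul homogeneous_monomial)
  from this[of "Poly_Mapping.keys f"] assms(1)
  have "P (\<Sum>\<alpha>\<in>Poly_Mapping.keys f. cmul (coeff_at f \<alpha>) (monomial \<alpha>))"
    by (simp add: homogeneous_def)
  then show ?thesis
    by (subst sum)
qed

context
  fixes e :: nat and D :: "('n::finite) cpoly \<Rightarrow> 'n cpoly \<Rightarrow> complex"
  assumes D: "is_monomial_hermitian e D"
begin

lemma hermitian_add:
  "homogeneous e f \<Longrightarrow> homogeneous e g \<Longrightarrow> homogeneous e h \<Longrightarrow> D (f + g) h = D f h + D g h"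
  using D[unfolded is_monomial_hermitian_def, THEN conjunct1] by blast

lemma hermitian_cmul:
  "homogeneous e f \<Longrightarrow> homogeneous e h \<Longrightarrow> D (cmul a f) h = a * D f h"
  using D[unfolded is_monomial_hermitian_def, THEN conjunct2, THEN conjunct1] by blast

lemma hermitian_sym:
  "homogeneous e f \<Longrightarrow> homogeneous e g \<Longrightarrow> D g f = cnj (D f g)"
  using D[unfolded is_monomial_hermitian_def, THEN conjunct2, THEN conjunct2, THEN conjunct1]
  by blast

lemma hermitian_monomial:
  assumes "\<alpha> \<in> exponents e" "\<beta> \<in> exponents e"
  shows "D (monomial \<alpha>) (monomial \<beta>) =
    (if \<alpha> = \<beta> then complex_of_real (expo_weight e \<alpha>) else 0)"
  using D[unfolded is_monomial_hermitian_def, THEN conjunct2, THEN conjunct2, THEN conjunct2] assms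
  by simp

lemma hermitian_zero: "homogeneous e h \<Longrightarrow> D 0 h = 0"
  using hermitian_add[of 0 0 h] by (simp add: homogeneous_0)

lemma hermitian_step:
  "\<alpha> \<in> exponents e \<Longrightarrow> homogeneous e g \<Longrightarrow> homogeneous e h \<Longrightarrow>
    D (cmul a (monomial \<alpha>) + g) h = a * D (monomial \<alpha>) h + D g h"
  by (simp add: hermitian_add hermitian_cmul homogeneous_cmul homogeneous_monomial)

end

lemma herm_unique:
  assumes B: "is_monomial_hermitian e B" and C: "is_monomial_hermitian e C"
    and f: "homogeneous e f" and g: "homogeneous e g"
  shows "B f g = C f g"
proof -
  have left: "B f (monomial \<beta>) = C f (monomial \<beta>)"
    if "homogeneous e f" and \<beta>: "\<beta> \<in> exponents e" for f \<beta>
    using that(1)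
  proof (induction f rule: homogeneous_induct)
    case zero
    show ?case
      by (simp add: hermitian_zero[OF B] hermitian_zero[OF C] homogeneous_monomial \<beta>)
  next
    case (step a \<alpha> g)
    then show ?case
      by (simp add: hermitian_step[OF B] hermitian_step[OF C] homogeneous_monomial \<beta>
          hermitian_monomial[OF B] hermitian_monomial[OF C])
  qed
  show ?thesis
    using f
  proof (induction f rule: homogeneous_induct)
    case zero
    show ?case
      by (simp add: hermitian_zero[OF B] hermitian_zero[OF C] g)
  next
    case (step a \<alpha> h)
    have "B (monomial \<alpha>) g = C (monomial \<alpha>) g"
      using left[OF g step(1)] hermitian_sym[OF B g homogeneous_monomial[OF step(1)]]
        hermitian_sym[OF C g homogeneous_monomial[OF step(1)]] by simp
    with step show ?case
      by (simp add: hermitian_step[OF B] hermitian_step[OF C] g)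
  qed
qed

end

theory Submission
  imports Defs
begin

text \<open>
  The weights \<open>\<surd>(\<alpha>!/e!)\<close> are the norms of the monomials, so \<open>w\<close> records the coordinates of a
  homogeneous polynomial in the orthonormal basis of normalised monomials.  It is therefore an
  isometry onto the standard hermitian space: \<open>\<langle>g, h\<rangle>\<close> is the dot product of
  the conjugate of \<open>w(h)\<close> with \<open>w(g)\<close> (\<open>herm_eq_dotvec\<close>).  Since partial derivatives of a cubic
  are quadratic forms (\<open>homogeneous_partial\<close>), this applies to \<open>\<parallel>f\<parallel>\<^sup>2\<close> and to all products of partial
  derivatives: \<open>L = \<parallel>f\<parallel>\<^sup>2\<close> and \<open>P\<^sub>i\<^sub>j = \<langle>\<partial>\<^sub>j f, \<partial>\<^sub>i f\<rangle>\<close>.  Hence \<open>P/(3L)\<close> is the hermitian matrix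
  \<open>H(f)\<close>, and \<open>d/n = 1\<close> for ternary cubics, so \<open>2(P/(3L) - I)\<close> is the moment matrix.  The square
  lengths are then given by the same formula, and real cubics are a special case of complex ones.
\<close>

text \<open>
  The right-hand side is the explicit form of the hermitian product with squared monomial norms
  \<open>\<alpha>!/e!\<close>: each weight splits into two equal square roots, one for each weighted vector.  The
  arguments are exchanged because \<open>\<langle>\<cdot>, \<cdot>\<rangle>\<close> is conjugate-linear in the second one, whereas the dot
  product carries the bar on the first.
\<close>

lemma herm_eq_dotvec:
  assumes "homogeneous e g" "homogeneous e h"
  shows "herm e g h = dotvec e (conjvec (wvec e h)) (wvec e g)"
proof -
  have sqrt_sq: "complex_of_real (sqrt (expo_weight e \<alpha>)) * complex_of_real (sqrt (expo_weight e \<alpha>))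
      = complex_of_real (expo_weight e \<alpha>)" for \<alpha> :: "'a expo"
    unfolding of_real_mult[symmetric] by (simp add: expo_weight_def prod_nonneg)
  have "herm e g h =
      (\<Sum>\<alpha>\<in>exponents e. complex_of_real (expo_weight e \<alpha>) * coeff_at g \<alpha> * cnj (coeff_at h \<alpha>))"
    by (rule herm_unique[OF herm_is_monomial_hermitian is_monomial_hermitian_exists assms])
  also have "\<dots> = dotvec e (conjvec (wvec e h)) (wvec e g)"
    by (simp add: dotvec_def conjvec_def wvec_def flip: sqrt_sq) (simp add: mult_ac)
  finally show ?thesis .
qed

text \<open>
  Each term of the derivative with nonzero coefficient comes from an exponent \<open>\<alpha>\<close> with
  \<open>\<alpha>\<^sub>i > 0\<close>, so the truncated subtraction there lowers the degree by exactly one.  In degree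
  \<open>0\<close> there is no such term, which is why \<open>d - 1\<close> may be truncated as well.
\<close>

lemma homogeneous_partial:
  assumes "homogeneous d f"
  shows "homogeneous (d - 1) (partial i f)"
proof -
  have single: "homogeneous (d - 1) (Poly_Mapping.single (\<alpha> - Poly_Mapping.single i 1)
      (of_nat (Poly_Mapping.lookup \<alpha> i) * coeff_at f \<alpha>))" if "\<alpha> \<in> Poly_Mapping.keys f" for \<alpha>
  proof (cases "Poly_Mapping.lookup \<alpha> i = 0")
    case True
    then show ?thesis by (simp add: homogeneous_0)
  next
    case False
    have "d = (\<Sum>j\<in>UNIV. Poly_Mapping.lookup \<alpha> j)"
      using assms that by (auto simp: homogeneous_def exponents_def)
    also have "\<dots> = (\<Sum>j\<in>UNIV. Poly_Mapping.lookup (\<alpha> - Poly_Mapping.single i 1) j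
        + (if j = i then 1 else 0))"
      using False by (intro sum.cong) (auto simp: lookup_minus lookup_single when_def)
    also have "\<dots> = (\<Sum>j\<in>UNIV. Poly_Mapping.lookup (\<alpha> - Poly_Mapping.single i 1) j) + 1"
      by (simp add: sum.distrib)
    finally show ?thesis
      by (simp add: homogeneous_def exponents_def)
  qed
  have "homogeneous (d - 1) (\<Sum>\<alpha>\<in>A. Poly_Mapping.single (\<alpha> - Poly_Mapping.single i 1)
      (of_nat (Poly_Mapping.lookup \<alpha> i) * coeff_at f \<alpha>))"
    if "finite A" "A \<subseteq> Poly_Mapping.keys f" for A
    using that by (induction A) (simp_all add: homogeneous_0 homogeneous_add single del: One_nat_def)
  then show ?thesis
    unfolding partial_def by simp
qed

lemma cubic_m_eq_moment_matrix:
  assumes f: "homogeneous 3 f"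
  shows "cubic_m f = moment_matrix 3 f"
proof -
  have partial: "homogeneous 2 (partial i f)" for i
    using homogeneous_partial[OF f, of i] by simp
  have "herm 3 f f = cubic_L f"
    unfolding cubic_L_def by (rule herm_eq_dotvec[OF f f])
  moreover have "herm 2 (partial j f) (partial i f) = cubic_P f $ i $ j" for i j
    by (simp add: cubic_P_def herm_eq_dotvec[OF partial partial])
  ultimately have "gradient_gram 3 f = map_matrix ((*) (1 / (3 * cubic_L f))) (cubic_P f)"
    by (simp add: gradient_gram_def map_matrix_def vec_eq_iff)
  then show ?thesis
    by (simp add: cubic_m_def moment_matrix_def)
qed

theorem theorem4p1:
  shows "(\<forall>f :: 3 cpoly. homogeneous 3 f \<and> f \<noteq> 0 \<longrightarrow>
            cubic_m f = moment_matrix 3 f \<and>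
            cubic_ell f = square_length (moment_matrix 3 f))
       \<and> (\<forall>f :: 3 cpoly. homogeneous 3 f \<and> f \<noteq> 0 \<and> (\<forall>\<alpha>. coeff_at f \<alpha> \<in> \<real>) \<longrightarrow>
            cubic_m f = moment_matrix 3 f \<and>
            cubic_ell f = square_length (moment_matrix 3 f))"
  by (simp add: cubic_m_eq_moment_matrix cubic_ell_def square_length_def)

end
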